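(* Let $(L,\delta,\lambda)$ be a pro-nilpotent curved $L_\infty$-algebra (in the shifted convention, all brackets having degree $1$) and let $(M,d)$ be a complete filtered complex. Let $$f:(M,d)\rightleftarrows(L,\delta):g ,\qquad h:L\to L[-1]$$ be a homological perturbation theory context: $f$ and $g$ are filtration-preserving morphisms of complexes with $gf=1_M$, $h$ is a filtration-preserving linear map of degree $-1$ with $1_L = fg+\delta h+h\delta$, and $h^2=0$, $hf=0$, $gh=0$. Equip $M$ with the transferred curved $L_\infty$-structure $\mu=g\,\lambda\bullet F\in S^1(M,M)$, where $F\in S^0(M,L)$ is the unique solution of the fixed-point equation $F=f-h\,\lambda\bullet F$. Let $\mathsf{MC}(M)$ be the set of Maurer--Cartan elements of $(M,d,\mu)$, and let $$\mathsf{MC}(L,h)=\{x\in\mathsf{MC}(L)\mid hx=0\} .$$ Then $x\mapsto g(x)$ defines a bijection from $\mathsf{MC}(L,h)$ to $\mathsf{MC}(M)$.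
   Context: All vector spaces are over a fixed field of characteristic $0$. **Complete filtered complexes.** A complete filtered complex is a cochain complex $(L^\bullet,\delta)$ ($\delta$ of degree $+1$, $\delta^2=0$) with a decreasing filtration $L=F_0L\supset F_1L\supset F_2L\supset\cdots$ by graded subspaces with $\delta(F_kL)\subset F_kL$, such that each $L^i$ is a complete (in particular Hausdorff) metric space for $d_c(x,y)=\inf\{c^{-k}\mid x-y\in F_kL\}$, where $c>1$ is any fixed real number. A linear map $u$ is filtration-preserving if $u(F_k)\subset F_k$ for all $k$. **Multilinear maps.** For complete filtered complexes $L,M$, let $S^{n,i}(L,M)$ be the space of $n$-linear maps $a_n$ from $L$ to $M$ that are graded symmetric, i.e. $a_n(\dots,x_{j+1},x_j,\dots)=(-1)^{|x_j||x_{j+1}|}a_n(\dots,x_j,x_{j+1},\dots)$; filtered, i.e. $a_n(F_{k_1}L,\dots,F_{k_n}L)\subset F_{k_1+\dots+k_n}M$; and of degree $i$, i.e. $|a_n(x_1,\dots,x_n)|=|x_1|+\dots+|x_n|+i$. Put $$S^i(L,M)=F_1M^i\times\prod_{n\ge1}S^{n,i}(L,M),$$ with elements $a=(a_0,a_1,a_2,\dots)$, and filtration $$F_kS^i(L,M)=\{a\in S^i(L,M)\mid a_n(F_{k_1}L,\dots,F_{k_n}L)\subset F_{k_1+\dots+k_n+k}M\ \text{for all } n,k_1,\dots,k_n\}.$$ A filtration-preserving linear map is regarded as an element of $S^i$ concentrated in the component $n=1$. The differential on $S^i(L,M)$ is $$(\delta a)_n(x_1,\dots,x_n)=\delta_M\,a_n(x_1,\dots,x_n)-(-1)^{i}\sum_{j}(-1)^{|x_1|+\dots+|x_{j-1}|}a_n(x_1,\dots,\delta_Lx_j,\dots,x_n).$$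 **Products.** For $a\in S^i(L,M)$, $b\in S^j(L,L)$, define $a\circ b\in S^{i+j}(L,M)$ by $$(a\circ b)_n(x_1,\dots,x_n)=\sum_{\sigma\in S_n}(-1)^{\varepsilon}\sum_{k=0}^n\frac{1}{k!(n-k)!}\,a_{n-k+1}\bigl(b_k(x_{\sigma_1},\dots,x_{\sigma_k}),x_{\sigma_{k+1}},\dots,x_{\sigma_n}\bigr).$$ For $a\in S^i(L,M)$, $b\in S^0(K,L)$, define $a\bullet b\in S^i(K,M)$ by $$(a\bullet b)_n(x_1,\dots,x_n)=\sum_{\sigma\in S_n}(-1)^{\varepsilon}\sum_{k=0}^\infty\frac1{k!}\sum_{n_1+\dots+n_k=n}\frac{1}{n_1!\cdots n_k!}\,a_k\bigl(b_{n_1}(x_{\sigma_1},\dots),\dots,b_{n_k}(\dots,x_{\sigma_n})\bigr),$$ where $n_1,\dots,n_k\ge0$ (the sum converges because $b_0\in F_1L$). In both formulas $(-1)^\varepsilon$ is the Koszul sign of the permutation $(x_1,\dots,x_n)\mapsto(x_{\sigma_1},\dots,x_{\sigma_n})$. If $u$ is a linear map, $u\,\lambda\bullet F$ means $u$ composed with each component of $\lambda\bullet F$. **Curved $L_\infty$-algebras.** A curved $L_\infty$-algebra $(L,\delta,\lambda)$ is a complete filtered complex $(L,\delta)$ with $\lambda\in S^1(L,L)$ such that $\delta\lambda+\lambda\circ\lambda=0$. It is pro-nilpotent if $\lambda\in F_1S^1(L,L)$. (Here $L=\mathfrak{G}[1]$ is the shift of a curved $L_\infty$-algebra $\mathfrak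 G$ in the unshifted convention, where the brackets have degree $2-n$ and Maurer--Cartan elements lie in $F_1\mathfrak{G}^1$; the unary bracket of $\mathfrak G$ corresponds to $\delta+\lambda_1$.) **Maurer--Cartan elements.** $\mathsf{MC}(L)$ is the set of $x\in F_1L^0$ with $$\delta x+\sum_{n=0}^\infty\frac1{n!}\lambda_n(x,\dots,x)=0 ,$$ and likewise $\mathsf{MC}(M)$ is the set of $y\in F_1M^0$ with $dy+\sum_{n\ge0}\frac1{n!}\mu_n(y,\dots,y)=0$. **Transferred structure.** When $\lambda$ is pro-nilpotent, a theorem of Fukaya states that the equation $F=f-h\,\lambda\bullet F$ has a unique solution $F\in S^0(M,L)$, and that $\mu=g\,\lambda\bullet F$ makes $(M,d,\mu)$ a curved $L_\infty$-algebra. *)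

theory Defs
  imports "HOL-Analysis.Abstract_Metric_Spaces" "HOL-Combinatorics.Permutations"
begin

section \<open>Complete filtered complexes\<close>

text \<open>The underlying ungraded vector space is the whole type \<open>'v\<close>; \<open>gr C i\<close> is the
  subspace of elements of degree \<open>i\<close>, and \<open>flt C k\<close> is the \<open>k\<close>-th filtration step.\<close>

record ('k, 'v) fcomplex =
  scl :: "'k \<Rightarrow> 'v \<Rightarrow> 'v"
  gr :: "int \<Rightarrow> 'v set"
  dif :: "'v \<Rightarrow> 'v"
  flt :: "nat \<Rightarrow> 'v set"

definition is_decomposition ::
    "('k, 'v::ab_group_add) fcomplex \<Rightarrow> 'v \<Rightarrow> (int \<Rightarrow> 'v) \<Rightarrow> bool" where
  "is_decomposition C x p \<longleftrightarrow>
     (\<forall>i. p i \<in> gr C i) \<and> finite {i. p i \<noteq> 0} \<and> x = (\<Sum>i | p i \<noteq> 0. p i)"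

definition component :: "('k, 'v::ab_group_add) fcomplex \<Rightarrow> 'v \<Rightarrow> int \<Rightarrow> 'v" where
  "component C x = (THE p. is_decomposition C x p)"

definition fdist :: "real \<Rightarrow> ('k, 'v::ab_group_add) fcomplex \<Rightarrow> 'v \<Rightarrow> 'v \<Rightarrow> real" where
  "fdist c C x y = Inf {1 / c ^ k | k. x - y \<in> flt C k}"

locale complete_filtered_complex = vector_space "scl C"
  for c :: real and C :: "('k::field_char_0, 'v::ab_group_add) fcomplex" +
  assumes gr_subspace: "subspace (gr C i)"
    and gr_direct_sum: "\<exists>!p. is_decomposition C x p"
    and dif_linear: "Vector_Spaces.linear (scl C) (scl C) (dif C)"
    and dif_degree: "x \<in> gr C i \<Longrightarrow> dif C x \<in> gr C (i + 1)"
    and dif_square: "dif C (dif C x) = 0"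
    and flt_0: "flt C 0 = UNIV"
    and flt_decreasing: "flt C (Suc k) \<subseteq> flt C k"
    and flt_subspace: "subspace (flt C k)"
    and flt_graded: "x \<in> flt C k \<Longrightarrow> component C x i \<in> flt C k"
    and dif_flt: "x \<in> flt C k \<Longrightarrow> dif C x \<in> flt C k"
    and c_gt_1: "c > 1"
    and metric: "Metric_space (gr C i) (fdist c C)"
    and complete: "Metric_space.mcomplete (gr C i) (fdist c C)"

text \<open>Limits for the metric \<^term>\<open>fdist c C\<close>; see \<open>fil_lim_iff_fdist\<close> below.\<close>

definition fil_lim :: "('k, 'v::ab_group_add) fcomplex \<Rightarrow> (nat \<Rightarrow> 'v) \<Rightarrow> 'v \<Rightarrow> bool" where
  "fil_lim C s l \<longleftrightarrow> (\<forall>k. \<forall>\<^sub>F n in sequentially. s n - l \<in> flt C k)"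

definition fil_suminf :: "('k, 'v::ab_group_add) fcomplex \<Rightarrow> (nat \<Rightarrow> 'v) \<Rightarrow> 'v" where
  "fil_suminf C s = (THE l. fil_lim C (\<lambda>n. \<Sum>j<n. s j) l)"

definition filtration_preserving ::
    "('k, 'v) fcomplex \<Rightarrow> ('k, 'w) fcomplex \<Rightarrow> ('v \<Rightarrow> 'w) \<Rightarrow> bool" where
  "filtration_preserving C D u \<longleftrightarrow> (\<forall>k. u ` flt C k \<subseteq> flt D k)"

definition degree_map ::
    "int \<Rightarrow> ('k, 'v) fcomplex \<Rightarrow> ('k, 'w) fcomplex \<Rightarrow> ('v \<Rightarrow> 'w) \<Rightarrow> bool" where
  "degree_map r C D u \<longleftrightarrow> (\<forall>i. u ` gr C i \<subseteq> gr D (i + r))"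


section \<open>Multilinear maps\<close>

text \<open>An element \<open>a = (a\<^sub>0, a\<^sub>1, a\<^sub>2, \<dots>)\<close> of the product is encoded as a single function on
  lists: its restriction to lists of length \<open>n\<close> is \<open>a\<^sub>n\<close>.\<close>

definition signed :: "int \<Rightarrow> 'v::ab_group_add \<Rightarrow> 'v" where
  "signed m v = (if even m then v else - v)"

definition S_space :: "int \<Rightarrow> ('k::field_char_0, 'v::ab_group_add) fcomplex \<Rightarrow>
    ('k, 'w::ab_group_add) fcomplex \<Rightarrow> ('v list \<Rightarrow> 'w) set" where
  "S_space i L M = {a.
     a [] \<in> flt M 1 \<inter> gr M i \<and>
     (\<forall>xs ys. Vector_Spaces.linear (scl L) (scl M) (\<lambda>x. a (xs @ x # ys))) \<and>
     (\<forall>xs ys p q. \<forall>x\<in>gr L p. \<forall>y\<in>gr L q.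
        a (xs @ y # x # ys) = signed (p * q) (a (xs @ x # y # ys))) \<and>
     (\<forall>ks xs. xs \<noteq> [] \<longrightarrow> list_all2 (\<lambda>x k. x \<in> flt L k) xs ks \<longrightarrow> a xs \<in> flt M (sum_list ks)) \<and>
     (\<forall>ds xs. xs \<noteq> [] \<longrightarrow> list_all2 (\<lambda>x d. x \<in> gr L d) xs ds \<longrightarrow> a xs \<in> gr M (sum_list ds + i))}"

definition S_filt :: "nat \<Rightarrow> int \<Rightarrow> ('k::field_char_0, 'v::ab_group_add) fcomplex \<Rightarrow>
    ('k, 'w::ab_group_add) fcomplex \<Rightarrow> ('v list \<Rightarrow> 'w) set" where
  "S_filt k i L M = {a \<in> S_space i L M.
     \<forall>ks xs. list_all2 (\<lambda>x k. x \<in> flt L k) xs ks \<longrightarrow> a xs \<in> flt M (sum_list ks + k)}"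

definition lin_elem :: "('v \<Rightarrow> 'w::zero) \<Rightarrow> 'v list \<Rightarrow> 'w" where
  "lin_elem u xs = (case xs of [x] \<Rightarrow> u x | _ \<Rightarrow> 0)"

text \<open>Formulas involving degrees are only given on homogeneous arguments. If
  \<open>\<Phi> ds xs\<close> is such a formula for arguments \<open>xs\<close> of degrees \<open>ds\<close>, then
  \<open>multilinear_ext L \<Phi>\<close> is its multilinear extension to arbitrary arguments, obtained by
  decomposing every argument into its homogeneous components.\<close>

definition multilinear_ext :: "('k, 'v::ab_group_add) fcomplex \<Rightarrow>
    (int list \<Rightarrow> 'v list \<Rightarrow> 'w::ab_group_add) \<Rightarrow> 'v list \<Rightarrow> 'w" where
  "multilinear_ext L \<Phi> xs =
     (\<Sum>ds | list_all2 (\<lambda>x d. component L x d \<noteq> 0) xs ds. \<Phi> ds (map2 (component L) xs ds))"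

definition S_dif :: "int \<Rightarrow> ('k, 'v::ab_group_add) fcomplex \<Rightarrow> ('k, 'w::ab_group_add) fcomplex \<Rightarrow>
    ('v list \<Rightarrow> 'w) \<Rightarrow> 'v list \<Rightarrow> 'w" where
  "S_dif i L M a = multilinear_ext L (\<lambda>ds xs.
     dif M (a xs) -
     signed i (\<Sum>j<length xs. signed (sum_list (take j ds)) (a (xs[j := dif L (xs ! j)]))))"

text \<open>The permuted list \<open>permute_args \<sigma> xs\<close> is \<open>x\<^bsub>\<sigma> 0\<^esub>, \<dots>, x\<^bsub>\<sigma> (n-1)\<^esub>\<close> (indices start at
  \<open>0\<close>). Its Koszul sign picks up \<open>(-1)\<close> to the \<open>|x| |y|\<close> for each pair \<open>x, y\<close> whose order
  is reversed.\<close>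

definition permute_args :: "(nat \<Rightarrow> nat) \<Rightarrow> 'v list \<Rightarrow> 'v list" where
  "permute_args \<sigma> xs = map (\<lambda>j. xs ! \<sigma> j) [0..<length xs]"

definition koszul :: "int list \<Rightarrow> (nat \<Rightarrow> nat) \<Rightarrow> int" where
  "koszul ds \<sigma> =
     (\<Sum>(i, j) | i < j \<and> j < length ds \<and> \<sigma> i > \<sigma> j. ds ! \<sigma> i * ds ! \<sigma> j)"

definition circ :: "('k::field_char_0, 'v::ab_group_add) fcomplex \<Rightarrow>
    ('k, 'w::ab_group_add) fcomplex \<Rightarrow>
    ('v list \<Rightarrow> 'w) \<Rightarrow> ('v list \<Rightarrow> 'v) \<Rightarrow> 'v list \<Rightarrow> 'w" where
  "circ L M a b = multilinear_ext L (\<lambda>ds xs.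
     \<Sum>\<sigma> | \<sigma> permutes {..<length xs}. signed (koszul ds \<sigma>)
       (\<Sum>k\<le>length xs. scl M (1 / (fact k * fact (length xs - k)))
          (a (b (take k (permute_args \<sigma> xs)) # drop k (permute_args \<sigma> xs)))))"

fun split_blocks :: "nat list \<Rightarrow> 'v list \<Rightarrow> 'v list list" where
  "split_blocks [] xs = []"
| "split_blocks (n # ns) xs = take n xs # split_blocks ns (drop n xs)"

definition bullet :: "('k::field_char_0, 'u::ab_group_add) fcomplex \<Rightarrow>
    ('k, 'w::ab_group_add) fcomplex \<Rightarrow>
    ('v list \<Rightarrow> 'w) \<Rightarrow> ('u list \<Rightarrow> 'v) \<Rightarrow> 'u list \<Rightarrow> 'w" where
  "bullet K M a b = multilinear_ext K (\<lambda>ds xs.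
     \<Sum>\<sigma> | \<sigma> permutes {..<length xs}. signed (koszul ds \<sigma>)
       (fil_suminf M (\<lambda>k. scl M (1 / fact k)
          (\<Sum>ns | length ns = k \<and> sum_list ns = length xs.
             scl M (1 / (\<Prod>n\<leftarrow>ns. fact n))
               (a (map b (split_blocks ns (permute_args \<sigma> xs))))))))"


section \<open>Curved L-infinity algebras and homological perturbation theory\<close>

definition curved_Linf :: "real \<Rightarrow> ('k::field_char_0, 'v::ab_group_add) fcomplex \<Rightarrow>
    ('v list \<Rightarrow> 'v) \<Rightarrow> bool" where
  "curved_Linf c L lam \<longleftrightarrow>
     complete_filtered_complex c L \<and> lam \<in> S_space 1 L L \<and>
     (\<forall>xs. S_dif 1 L L lam xs + circ L L lam lam xs = 0)"

definition pro_nilpotent :: "('k::field_char_0, 'v::ab_group_add) fcomplex \<Rightarrow>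
    ('v list \<Rightarrow> 'v) \<Rightarrow> bool" where
  "pro_nilpotent L lam \<longleftrightarrow> lam \<in> S_filt 1 1 L L"

definition MC :: "('k::field_char_0, 'v::ab_group_add) fcomplex \<Rightarrow> ('v list \<Rightarrow> 'v) \<Rightarrow> 'v set" where
  "MC L lam = {x \<in> flt L 1 \<inter> gr L 0.
     dif L x + fil_suminf L (\<lambda>n. scl L (1 / fact n) (lam (replicate n x))) = 0}"

definition MC_gauge :: "('k::field_char_0, 'v::ab_group_add) fcomplex \<Rightarrow> ('v list \<Rightarrow> 'v) \<Rightarrow>
    ('v \<Rightarrow> 'v) \<Rightarrow> 'v set" where
  "MC_gauge L lam h = {x \<in> MC L lam. h x = 0}"

definition complex_morphism :: "('k::field_char_0, 'v::ab_group_add) fcomplex \<Rightarrow>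
    ('k, 'w::ab_group_add) fcomplex \<Rightarrow> ('v \<Rightarrow> 'w) \<Rightarrow> bool" where
  "complex_morphism C D u \<longleftrightarrow>
     Vector_Spaces.linear (scl C) (scl D) u \<and> degree_map 0 C D u \<and>
     (\<forall>x. u (dif C x) = dif D (u x))"

definition hpt_context :: "('k::field_char_0, 'v::ab_group_add) fcomplex \<Rightarrow>
    ('k, 'w::ab_group_add) fcomplex \<Rightarrow> ('w \<Rightarrow> 'v) \<Rightarrow> ('v \<Rightarrow> 'w) \<Rightarrow> ('v \<Rightarrow> 'v) \<Rightarrow> bool" where
  "hpt_context L M f g h \<longleftrightarrow>
     complex_morphism M L f \<and> filtration_preserving M L f \<and>
     complex_morphism L M g \<and> filtration_preserving L M g \<and>
     (\<forall>y. g (f y) = y) \<and>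
     Vector_Spaces.linear (scl L) (scl L) h \<and> degree_map (-1) L L h \<and>
     filtration_preserving L L h \<and>
     (\<forall>x. x = f (g x) + dif L (h x) + h (dif L x)) \<and>
     (\<forall>x. h (h x) = 0) \<and> (\<forall>y. h (f y) = 0) \<and> (\<forall>x. g (h x) = 0)"


section \<open>Consistency of the encodings\<close>

context complete_filtered_complex
begin

lemma flt_antimono: "j \<le> k \<Longrightarrow> flt C k \<subseteq> flt C j"
  using flt_decreasing by (rule lift_Suc_antimono_le)

lemma fdist_less_iff: "fdist c C x y < 1 / c ^ k \<longleftrightarrow> x - y \<in> flt C (Suc k)"
proof -
  let ?A = "{1 / c ^ k | k. x - y \<in> flt C k}"
  have bdd: "bdd_below ?A"
    using c_gt_1 by (intro bdd_belowI[of _ 0]) auto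
  have "1 / c ^ 0 \<in> ?A"
    using flt_0 by blast
  then have ne: "?A \<noteq> {}"
    by blast
  show ?thesis
  proof
    assume "fdist c C x y < 1 / c ^ k"
    then obtain j where j: "x - y \<in> flt C j" "1 / c ^ j < 1 / c ^ k"
      unfolding fdist_def using cInf_less_iff[OF ne bdd] by blast
    from j(2) have "k < j"
      using c_gt_1 by (simp add: divide_simps power_strict_increasing_iff)
    with j(1) show "x - y \<in> flt C (Suc k)"
      using flt_antimono[of "Suc k" j] by auto
  next
    assume "x - y \<in> flt C (Suc k)"
    then have "fdist c C x y \<le> 1 / c ^ Suc k"
      unfolding fdist_def using bdd by (intro cInf_lower) blast
    also have "\<dots> < 1 / c ^ k"
      using c_gt_1 by (simp add: divide_simps)
    finally show "fdist c C x y < 1 / c ^ k" .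
  qed
qed

lemma fdist_nonneg: "fdist c C x y \<ge> 0"
  unfolding fdist_def using c_gt_1 flt_0 by (intro cInf_greatest) auto

lemma fil_lim_iff_fdist: "fil_lim C s l \<longleftrightarrow> (\<lambda>n. fdist c C (s n) l) \<longlonglongrightarrow> 0"
proof
  assume L: "fil_lim C s l"
  show "(\<lambda>n. fdist c C (s n) l) \<longlonglongrightarrow> 0"
  proof (rule order_tendstoI)
    fix e :: real
    assume "e < 0"
    then show "\<forall>\<^sub>F n in sequentially. e < fdist c C (s n) l"
      using fdist_nonneg by (intro always_eventually allI) (meson less_le_trans)
  next
    fix e :: real
    assume e: "0 < e"
    obtain k where "(1 / c) ^ k < e"
      using real_arch_pow_inv[of e "1 / c"] e c_gt_1 by auto
    then have k: "1 / c ^ k < e"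
      by (simp add: power_divide)
    have "\<forall>\<^sub>F n in sequentially. s n - l \<in> flt C (Suc k)"
      using L unfolding fil_lim_def by blast
    then show "\<forall>\<^sub>F n in sequentially. fdist c C (s n) l < e"
      by eventually_elim (use k fdist_less_iff less_trans in blast)
  qed
next
  assume L: "(\<lambda>n. fdist c C (s n) l) \<longlonglongrightarrow> 0"
  show "fil_lim C s l"
    unfolding fil_lim_def
  proof
    fix k
    have "1 / c ^ k > 0"
      using c_gt_1 by simp
    then have "\<forall>\<^sub>F n in sequentially. fdist c C (s n) l < 1 / c ^ k"
      using L by (rule order_tendstoD(2)[rotated])
    then show "\<forall>\<^sub>F n in sequentially. s n - l \<in> flt C k"
      by eventually_elim (use fdist_less_iff flt_decreasing in blast)
  qed
qed

lemma component_homogeneous: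
  assumes "x \<in> gr C i"
  shows "component C x = (\<lambda>j. if j = i then x else 0)"
proof -
  have "is_decomposition C x (\<lambda>j. if j = i then x else 0)"
  proof (cases "x = 0")
    case False
    then have "{j. (if j = i then x else 0) \<noteq> 0} = {i}"
      by auto
    with assms show ?thesis
      using gr_subspace by (auto simp: is_decomposition_def subspace_0)
  qed (use gr_subspace in \<open>auto simp: is_decomposition_def subspace_0\<close>)
  then show ?thesis
    unfolding component_def using gr_direct_sum by (blast intro: the1_equality)
qed

lemma multilinear_ext_homogeneous:
  assumes "list_all2 (\<lambda>x d. x \<in> gr C d) xs ds" and "0 \<notin> set xs"
  shows "multilinear_ext C \<Phi> xs = \<Phi> ds xs"
proof -
  have len: "length xs = length ds"
    using assms(1) by (rule list_all2_lengthD)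
  have comp: "component C (xs ! j) = (\<lambda>d. if d = ds ! j then xs ! j else 0)"
    if "j < length xs" for j
    using assms(1) that component_homogeneous by (auto simp: list_all2_conv_all_nth)
  have nz: "xs ! j \<noteq> 0" if "j < length xs" for j
    using assms(2) that nth_mem by fastforce
  have "{es. list_all2 (\<lambda>x d. component C x d \<noteq> 0) xs es} = {ds}"
    using len comp nz by (auto simp: list_all2_conv_all_nth intro!: nth_equalityI split: if_splits)
  moreover have "map2 (component C) xs ds = xs"
    using len comp by (auto intro!: nth_equalityI)
  ultimately show ?thesis
    by (simp add: multilinear_ext_def)
qed

end

end

(* Write Lam(x) = sum lam_n(x,...,x)/n! and Phi(y) = sum F_n(y,...,y)/n!.  Composition of Taylor
   series turns the equations for F and mu into Phi(y) = f y - h Lam(Phi y) and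
   sum mu_n(y,...,y)/n! = g Lam(Phi y).  Phi is the inverse of g.

   If x is Maurer-Cartan with h x = 0, then x = f g x + h dx = f g x - h Lam(x).  As lam lies in
   F_1, the map z |-> f y - h Lam(z) is a contraction, so x = Phi(g x), and applying g to the
   Maurer-Cartan equation of x gives that of g x.

   Conversely let y be Maurer-Cartan, x = Phi(y) and R = dx + Lam(x).  Then g R = 0 and h R = 0,
   so R = h dR.  By the Bianchi identity dR = - sum lam(R,x,...,x)/m!, so R in F_m implies
   R in F_{m+1}, and R = 0 because the filtration is Hausdorff. *)

theory Submission
  imports Defs
begin

section \<open>Convergent series in a complete filtered complex\<close>

context complete_filtered_complex
begin

lemmas flt_zero [simp] = subspace_0[OF flt_subspace]
lemmas flt_add = subspace_add[OF flt_subspace]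
lemmas flt_diff = subspace_diff[OF flt_subspace]
lemmas flt_neg = subspace_neg[OF flt_subspace]
lemmas flt_scale = subspace_scale[OF flt_subspace]
lemmas flt_sum = subspace_sum[OF flt_subspace]

lemma flt_mono: "x \<in> flt C k \<Longrightarrow> j \<le> k \<Longrightarrow> x \<in> flt C j"
  using flt_antimono by blast

lemma flt_trans: "x - y \<in> flt C k \<Longrightarrow> y - z \<in> flt C k \<Longrightarrow> x - z \<in> flt C k"
  using flt_add[of "x - y" k "y - z"] by simp

lemma flt_diff_commute: "x - y \<in> flt C k \<Longrightarrow> y - x \<in> flt C k"
  using flt_neg[of "x - y" k] by simp

text \<open>The Hausdorff property is assumed only inside each \<open>gr C i\<close>. Since the
  filtration steps are graded, every homogeneous component of \<open>x\<close> again lies in all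
  steps, so it has distance 0 from 0.\<close>

lemma flt_separated:
  assumes "\<And>k. x \<in> flt C k"
  shows "x = 0"
proof -
  obtain p where p: "is_decomposition C x p"
    using gr_direct_sum by blast
  then have comp: "component C x = p"
    unfolding component_def using gr_direct_sum by (blast intro: the1_equality)
  have "p i = 0" for i
  proof -
    have mem: "p i \<in> gr C i"
      using p by (simp add: is_decomposition_def)
    have zero: "0 \<in> gr C i"
      using gr_subspace subspace_0 by blast
    have "fdist c C (p i) 0 < 1 / c ^ k" for k
      using flt_graded[OF assms] comp by (simp add: fdist_less_iff)
    moreover have "\<exists>k. 1 / c ^ k < e" if "0 < e" for e :: real
      using real_arch_pow_inv[of e "1 / c"] that c_gt_1 by (auto simp: power_divide)
    ultimately have "fdist c C (p i) 0 = 0"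
      using fdist_nonneg by (metis less_asym less_eq_real_def)
    then show ?thesis
      using Metric_space.zero[OF metric mem zero] by simp
  qed
  then show ?thesis
    using p by (simp add: is_decomposition_def)
qed

text \<open>The estimate gives convergence to \<open>l\<close>. As \<open>fil_suminf\<close> is a
  definite description, uniqueness of the limit is needed too; it comes from
  \<open>flt_separated\<close>.\<close>

lemma fil_suminf_eqI:
  assumes "\<And>n. l - (\<Sum>j<n. s j) \<in> flt C n"
  shows "fil_suminf C s = l"
  unfolding fil_suminf_def
proof (rule the_equality)
  show *: "fil_lim C (\<lambda>n. \<Sum>j<n. s j) l"
    unfolding fil_lim_def eventually_sequentially
    by (meson assms flt_mono flt_diff_commute)
  show "l' = l" if "fil_lim C (\<lambda>n. \<Sum>j<n. s j) l'" for l'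
  proof -
    have "l' - l \<in> flt C k" for k
    proof -
      have "\<forall>\<^sub>F n in sequentially. (\<Sum>j<n. s j) - l' \<in> flt C k \<and> (\<Sum>j<n. s j) - l \<in> flt C k"
        using that * by (auto simp: fil_lim_def eventually_conj_iff)
      then obtain n where "(\<Sum>j<n. s j) - l' \<in> flt C k" "(\<Sum>j<n. s j) - l \<in> flt C k"
        by (auto simp: eventually_sequentially)
      then show ?thesis
        by (meson flt_trans flt_diff_commute)
    qed
    then show ?thesis
      using flt_separated[of "l' - l"] by simp
  qed
qed

text \<open>Partial sums beyond the \<open>n\<close>-th agree modulo \<open>flt C n\<close>, so they
  are Cauchy in the complete space \<open>gr C i\<close>. The limit inherits this agreement, by
  comparison with a partial sum far enough out.\<close>

lemma
  assumes s: "\<And>j. s j \<in> gr C i" "\<And>j. s j \<in> flt C j"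
  shows fil_suminf_gr: "fil_suminf C s \<in> gr C i"
    and fil_suminf_remainder: "fil_suminf C s - (\<Sum>j<n. s j) \<in> flt C n"
proof -
  let ?S = "\<lambda>n. \<Sum>j<n. s j"
  interpret Metric_space "gr C i" "fdist c C"
    by (rule metric)
  have S: "?S m - ?S n \<in> flt C n" if "n \<le> m" for m n
  proof -
    have "?S m - ?S n = sum s {n..<m}"
      using sum_diff_nat_ivl[of 0 n m s] that by (simp add: atLeast0LessThan)
    then show ?thesis
      using flt_mono[OF s(2)] by (auto intro: flt_sum)
  qed
  have "MCauchy ?S"
    unfolding MCauchy_def
  proof (intro conjI allI impI)
    show "range ?S \<subseteq> gr C i"
      using s(1) gr_subspace by (auto intro: subspace_sum)
    fix e :: real
    assume "e > 0"
    then obtain k where k: "1 / c ^ k < e"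
      using real_arch_pow_inv[of e "1 / c"] c_gt_1 by (auto simp: power_divide)
    have "fdist c C (?S m) (?S n) < e" if "Suc k \<le> m" "Suc k \<le> n" for m n
    proof -
      have "?S m - ?S n \<in> flt C (Suc k)"
        by (meson that S flt_trans flt_diff_commute)
      then show ?thesis
        by (metis k fdist_less_iff less_trans)
    qed
    then show "\<exists>N. \<forall>n n'. N \<le> n \<longrightarrow> N \<le> n' \<longrightarrow> fdist c C (?S n) (?S n') < e"
      by blast
  qed
  then obtain l where "limitin mtopology ?S l sequentially"
    using complete[of i] unfolding mcomplete_def by blast
  then have l: "l \<in> gr C i" "\<And>e. e > 0 \<Longrightarrow> \<forall>\<^sub>F n in sequentially. fdist c C (?S n) l < e"
    by (auto simp: limitin_metric elim: eventually_mono)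
  have rem: "l - ?S n \<in> flt C n" for n
  proof -
    have "\<forall>\<^sub>F m in sequentially. fdist c C (?S m) l < 1 / c ^ n"
      using c_gt_1 by (intro l) simp
    then obtain m where "m \<ge> n" "fdist c C (?S m) l < 1 / c ^ n"
      unfolding eventually_sequentially by (meson linear)
    then have "l - ?S m \<in> flt C n"
      by (meson fdist_less_iff flt_decreasing flt_diff_commute subsetD)
    then show ?thesis
      using S[OF \<open>m \<ge> n\<close>] by (rule flt_trans)
  qed
  then have "fil_suminf C s = l"
    by (rule fil_suminf_eqI)
  with l rem show "fil_suminf C s \<in> gr C i" "fil_suminf C s - ?S n \<in> flt C n"
    by simp_all
qed

text \<open>The zero vector has no nonzero component, so the sum defining
  \<open>multilinear_ext\<close> is empty on zero arguments. The formula itself must therefore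
  vanish there, which is the second hypothesis.\<close>

lemma multilinear_ext_replicate:
  assumes "x \<in> gr C d" and "x = 0 \<Longrightarrow> n > 0 \<Longrightarrow> \<Phi> (replicate n d) (replicate n x) = 0"
  shows "multilinear_ext C \<Phi> (replicate n x) = \<Phi> (replicate n d) (replicate n x)"
proof (cases "x = 0 \<and> n > 0")
  case True
  then have "component C x = (\<lambda>_. 0)"
    using component_homogeneous[OF assms(1)] by auto
  then have "{ds. list_all2 (\<lambda>x d. component C x d \<noteq> 0) (replicate n x) ds} = {}"
    using True by (auto simp: list_all2_conv_all_nth)
  then show ?thesis
    using True assms(2) by (simp add: multilinear_ext_def)
next
  case False
  then show ?thesis
    using assms(1) by (intro multilinear_ext_homogeneous) (auto simp: list_all2_conv_all_nth)
qed

end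

section \<open>Multilinear maps on equal arguments\<close>

text \<open>The power series with Taylor coefficients \<open>a\<close> at 0. For a bracket it is the
  nonlinear part of the Maurer-Cartan equation, and \<open>bullet\<close> corresponds to composition
  of such series.\<close>

definition taylor :: "('k::field_char_0, 'w::ab_group_add) fcomplex \<Rightarrow> ('v list \<Rightarrow> 'w) \<Rightarrow> 'v \<Rightarrow> 'w"
  where "taylor M a x = fil_suminf M (\<lambda>n. scl M (1 / fact n) (a (replicate n x)))"

lemma replicate_update: "j < n \<Longrightarrow> (replicate n x)[j := z] = replicate j x @ z # replicate (n - Suc j) x"
  by (auto simp: list_eq_iff_nth_eq nth_append nth_list_update nth_Cons')

lemma split_blocks_replicate:
  "sum_list ns = n \<Longrightarrow> split_blocks ns (replicate n x) = map (\<lambda>m. replicate m x) ns"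
  by (induction ns arbitrary: n) (auto simp: min_def)

lemma permute_args_replicate:
  assumes "\<sigma> permutes {..<n}"
  shows "permute_args \<sigma> (replicate n x) = replicate n x"
  using permutes_in_image[OF assms] by (auto simp: permute_args_def list_eq_iff_nth_eq)

lemma koszul_replicate:
  assumes "\<sigma> permutes {..<n}"
  shows "koszul (replicate n 0) \<sigma> = 0"
  unfolding koszul_def using permutes_in_image[OF assms] by (intro sum.neutral) auto

text \<open>A block of size \<open>n\<close> evaluated at a point of the first step has weight
  \<open>max 1 n\<close>, because an empty block already lies in that step. The total weight
  controls both the number of blocks and the number of arguments.\<close>

lemma sum_list_max_one:
  fixes ns :: "nat list"
  shows "length ns \<le> (\<Sum>n\<leftarrow>ns. max 1 n)" and "sum_list ns \<le> (\<Sum>n\<leftarrow>ns. max 1 n)"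
  by (induction ns) auto

locale complex_pair =
  L: complete_filtered_complex c L + M: complete_filtered_complex c M
  for c :: real
    and L :: "('k::field_char_0, 'v::ab_group_add) fcomplex"
    and M :: "('k, 'w::ab_group_add) fcomplex"
begin

lemma flt_image:
  "filtration_preserving L M u \<Longrightarrow> x \<in> flt L k \<Longrightarrow> u x \<in> flt M k"
  by (auto simp: filtration_preserving_def)

context
  fixes a :: "'v list \<Rightarrow> 'w" and i :: int
  assumes a: "a \<in> S_space i L M"
begin

lemma S_spaceD:
  shows "a [] \<in> flt M 1 \<inter> gr M i"
    and "\<forall>xs ys. Vector_Spaces.linear (scl L) (scl M) (\<lambda>x. a (xs @ x # ys))"
    and "\<forall>xs ys p q. \<forall>x\<in>gr L p. \<forall>y\<in>gr L q.
      a (xs @ y # x # ys) = signed (p * q) (a (xs @ x # y # ys))"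
    and "\<forall>ks xs. xs \<noteq> [] \<longrightarrow> list_all2 (\<lambda>x k. x \<in> flt L k) xs ks \<longrightarrow> a xs \<in> flt M (sum_list ks)"
    and "\<forall>ds xs. xs \<noteq> [] \<longrightarrow> list_all2 (\<lambda>x d. x \<in> gr L d) xs ds \<longrightarrow>
      a xs \<in> gr M (sum_list ds + i)"
  using a unfolding S_space_def mem_Collect_eq by - (elim conjE, assumption)+

lemma S_space_linear: "Vector_Spaces.linear (scl L) (scl M) (\<lambda>x. a (xs @ x # ys))"
  using S_spaceD(2) by (elim allE)

lemmas S_space_hom = S_space_linear[THEN Vector_Spaces.linear.axioms(3)]

lemma S_space_zero: "0 \<in> set xs \<Longrightarrow> a xs = 0"
  using module_hom.zero[OF S_space_hom] by (auto dest!: split_list)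

text \<open>Makes the estimates for \<open>S_filt r\<close> available with \<open>r = 0\<close>. The
  empty list, excluded in \<open>S_space\<close>, is harmless since step 0 is everything.\<close>

lemma S_space_S_filt: "a \<in> S_filt 0 i L M"
proof -
  have "a xs \<in> flt M (sum_list ks + 0)" if "list_all2 (\<lambda>x k. x \<in> flt L k) xs ks" for xs ks
    using S_spaceD(4) that M.flt_0 by (cases "xs = []") auto
  then show ?thesis
    unfolding S_filt_def using a by blast
qed

lemma S_space_gr: "list_all2 (\<lambda>x d. x \<in> gr L d) xs ds \<Longrightarrow> a xs \<in> gr M (sum_list ds + i)"
  using S_spaceD(1,5) by (cases "xs = []") auto

lemma S_space_gr_0: "set xs \<subseteq> gr L 0 \<Longrightarrow> a xs \<in> gr M i"
  using S_space_gr[of xs "replicate (length xs) 0"] nth_mem[of _ xs]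
  by (auto simp: list_all2_conv_all_nth sum_list_replicate subset_iff)

text \<open>Exchanging a degree 0 argument with any homogeneous one costs the sign of exponent
  \<open>0 * p\<close>, which is trivial.\<close>

lemma S_space_commute:
  assumes "x \<in> gr L 0" "z \<in> gr L p"
  shows "a (xs @ replicate j x @ z # ys) = a (xs @ z # replicate j x @ ys)"
proof (induction j arbitrary: ys)
  case (Suc j)
  have swap: "a (us @ x # z # vs) = a (us @ z # x # vs)" for us vs
    using S_spaceD(3) assms by (metis even_zero mult_zero_right signed_def)
  have "a (xs @ replicate (Suc j) x @ z # ys) = a ((xs @ replicate j x) @ x # z # ys)"
    by (metis append.assoc append_Cons replicate_Suc replicate_app_Cons_same)
  also have "\<dots> = a (xs @ replicate j x @ z # (x # ys))"
    by (subst swap) simp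
  also have "\<dots> = a (xs @ z # replicate (Suc j) x @ ys)"
    by (subst Suc.IH) (simp add: replicate_app_Cons_same)
  finally show ?case .
qed simp

text \<open>Multinomial expansion, indexed by ordered lists instead of multinomial coefficients so
  that it matches the lists of block sizes in \<open>bullet\<close>. The prefix \<open>xs\<close>
  carries the arguments already expanded.\<close>

lemma S_space_replicate_sum:
  assumes "finite A"
  shows "a (xs @ replicate k (\<Sum>n\<in>A. scl L (w n) (v n))) =
    (\<Sum>ns | set ns \<subseteq> A \<and> length ns = k. scl M (\<Prod>n\<leftarrow>ns. w n) (a (xs @ map v ns)))"
proof (induction k arbitrary: xs)
  case 0
  have "{ns. set ns \<subseteq> A \<and> length ns = 0} = {[]}"
    by auto
  then show ?case
    by simp
next
  case (Suc k)
  let ?s = "\<Sum>n\<in>A. scl L (w n) (v n)" and ?B = "{ns. set ns \<subseteq> A \<and> length ns = k}"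
  interpret hom: module_hom "scl L" "scl M" "\<lambda>x. a (xs @ x # replicate k ?s)"
    by (rule S_space_hom)
  have "a (xs @ replicate (Suc k) ?s) = (\<Sum>n\<in>A. scl M (w n) (a ((xs @ [v n]) @ replicate k ?s)))"
    using hom.sum[of "\<lambda>n. scl L (w n) (v n)" A] by (simp add: hom.scale)
  also have "\<dots> = (\<Sum>n\<in>A. \<Sum>ns\<in>?B. scl M (w n * (\<Prod>n\<leftarrow>ns. w n)) (a (xs @ v n # map v ns)))"
    unfolding Suc.IH by (simp add: M.scale_sum_right)
  also have "\<dots> = (\<Sum>(ns, n)\<in>?B \<times> A. scl M (w n * (\<Prod>n\<leftarrow>ns. w n)) (a (xs @ v n # map v ns)))"
    by (subst sum.swap) (simp add: sum.cartesian_product)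
  also have "\<dots> = (\<Sum>ns | set ns \<subseteq> A \<and> length ns = Suc k.
      scl M (\<Prod>n\<leftarrow>ns. w n) (a (xs @ map v ns)))"
  proof -
    have inj: "inj_on (\<lambda>(ns, n). n # ns) (?B \<times> A)"
      by (auto simp: inj_on_def)
    show ?thesis
      unfolding lists_length_Suc_eq sum.reindex[OF inj] by (intro sum.cong) auto
  qed
  finally show ?case .
qed

end

section \<open>Estimates for Taylor series on degree 0 elements of the first filtration step\<close>

context
  fixes a :: "'v list \<Rightarrow> 'w" and i :: int and r :: nat
  assumes a: "a \<in> S_filt r i L M"
begin

lemma S_filt_S_space: "a \<in> S_space i L M"
  using a by (simp add: S_filt_def)

lemma S_filt_flt: "list_all2 (\<lambda>x k. x \<in> flt L k) xs ks \<Longrightarrow> a xs \<in> flt M (sum_list ks + r)"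
  using a by (auto simp: S_filt_def)

lemma S_filt_Cons:
  assumes "z \<in> flt L m" "x \<in> flt L 1"
  shows "a (z # replicate n x) \<in> flt M (m + n + r)"
  using S_filt_flt[of "z # replicate n x" "m # replicate n 1"] assms
  by (auto simp: list_all2_conv_all_nth sum_list_replicate nth_Cons')

lemma S_filt_replicate:
  assumes "x \<in> flt L 1"
  shows "a (replicate n x) \<in> flt M (n + r)"
  using S_filt_flt[of "replicate n x" "replicate n 1"] assms
  by (auto simp: list_all2_conv_all_nth sum_list_replicate)

text \<open>Telescoping: \<open>x\<close> is replaced by \<open>x'\<close> one slot at a time, and
  each replacement changes the value by a term with \<open>x - x'\<close> in one slot and the others
  counted in step 0 only.\<close>

lemma S_filt_replicate_diff:
  assumes "x - x' \<in> flt L m"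
  shows "a (xs @ replicate n x) - a (xs @ replicate n x') \<in> flt M (m + r)"
proof (induction n arbitrary: xs)
  case (Suc n)
  let ?ys = "replicate n x"
  have "list_all2 (\<lambda>x k. x \<in> flt L k) (xs @ (x - x') # ?ys)
      (replicate (length xs) 0 @ m # replicate n 0)"
    using assms L.flt_0
    by (intro list_all2_appendI) (auto simp: list_all2_conv_all_nth nth_Cons')
  then have "a (xs @ (x - x') # ?ys) \<in> flt M (m + r)"
    using S_filt_flt by (fastforce simp: sum_list_replicate)
  then have "a (xs @ x # ?ys) - a (xs @ x' # ?ys) \<in> flt M (m + r)"
    by (simp add: module_hom.diff[OF S_space_hom[OF S_filt_S_space]])
  then show ?case
    using M.flt_trans Suc.IH[of "xs @ [x']"] by fastforce
qed simp

context
  fixes x assumes x: "x \<in> flt L 1" "x \<in> gr L 0"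
begin

lemma taylor_term:
  shows "scl M (1 / fact n) (a (replicate n x)) \<in> gr M i"
    and "scl M (1 / fact n) (a (replicate n x)) \<in> flt M n"
proof -
  have "a (replicate n x) \<in> gr M i"
    using x by (intro S_space_gr_0[OF S_filt_S_space]) auto
  then show "scl M (1 / fact n) (a (replicate n x)) \<in> gr M i"
    using M.gr_subspace M.subspace_scale by blast
  show "scl M (1 / fact n) (a (replicate n x)) \<in> flt M n"
    using S_filt_replicate[OF x(1)] M.flt_mono M.flt_scale by (meson le_add1)
qed

lemma taylor_gr: "taylor M a x \<in> gr M i"
  unfolding taylor_def using taylor_term by (rule M.fil_suminf_gr)

lemma taylor_remainder:
  "taylor M a x - (\<Sum>n<N. scl M (1 / fact n) (a (replicate n x))) \<in> flt M N"
  unfolding taylor_def using taylor_term by (rule M.fil_suminf_remainder)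

text \<open>The constant term lies in step 1 by the definition of \<open>S_space\<close>, and the
  rest of the series does by the remainder estimate.\<close>

lemma taylor_flt: "taylor M a x \<in> flt M 1"
proof -
  have "a [] \<in> flt M 1"
    using S_spaceD(1)[OF S_filt_S_space] by blast
  then show ?thesis
    using M.flt_add[OF taylor_remainder[of 1]] by fastforce
qed

end

text \<open>Both series may be cut off after \<open>m + r\<close> terms, and the finite sums are
  compared term by term. For \<open>r = 1\<close> this is the contraction estimate.\<close>

lemma taylor_diff:
  assumes "x \<in> flt L 1" "x \<in> gr L 0" "x' \<in> flt L 1" "x' \<in> gr L 0" "x - x' \<in> flt L m"
  shows "taylor M a x - taylor M a x' \<in> flt M (m + r)"
proof -
  let ?S = "\<lambda>x. \<Sum>n<m + r. scl M (1 / fact n) (a (replicate n x))"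
  have "?S x - ?S x' \<in> flt M (m + r)"
    unfolding sum_subtractf[symmetric] M.scale_right_diff_distrib[symmetric]
    using S_filt_replicate_diff[OF assms(5), of "[]"] by (auto intro!: M.flt_sum M.flt_scale)
  moreover have "taylor M a x - ?S x \<in> flt M (m + r)" "?S x' - taylor M a x' \<in> flt M (m + r)"
    using taylor_remainder M.flt_diff_commute assms by blast+
  ultimately show ?thesis
    using M.flt_trans by blast
qed

end

end

section \<open>Composition and the Bianchi identity\<close>

text \<open>Composition of Taylor series: expand \<open>a\<close> at the series of \<open>b\<close>
  and regroup by the total number of arguments. The form of a remainder estimate survives
  application of a filtration-preserving linear map, such as \<open>h\<close> or
  \<open>g\<close>.\<close>

lemma bullet_taylor_remainder:
  fixes K :: "('k::field_char_0, 'u::ab_group_add) fcomplex"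
    and L :: "('k, 'v::ab_group_add) fcomplex"
    and M :: "('k, 'w::ab_group_add) fcomplex"
  assumes "complete_filtered_complex c K" "complete_filtered_complex c L"
    and "complete_filtered_complex c M"
    and a: "a \<in> S_space i L M" and b: "b \<in> S_space 0 K L"
    and y: "y \<in> flt K 1" "y \<in> gr K 0"
  shows "taylor M a (taylor L b y) -
    (\<Sum>n<N. scl M (1 / fact n) (bullet K M a b (replicate n y))) \<in> flt M N"
proof -
  interpret K: complete_filtered_complex c K by fact
  interpret L: complete_filtered_complex c L by fact
  interpret M: complete_filtered_complex c M by fact
  interpret KL: complex_pair c K L ..
  interpret LM: complex_pair c L M ..
  note b' = KL.S_space_S_filt[OF b] and a' = LM.S_space_S_filt[OF a]
  define v where "v m = b (replicate m y)" for m
  define w where "w ns = scl M (1 / (\<Prod>n\<leftarrow>ns. fact n)) (a (map v ns))" for ns :: "nat list"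
  define A where "A k n = {ns :: nat list. length ns = k \<and> sum_list ns = n}" for k n
  define T where "T n k = scl M (1 / fact k) (\<Sum>ns\<in>A k n. w ns)" for n k
  have v_flt: "v m \<in> flt L (max 1 m)" for m
    using KL.S_spaceD(1)[OF b] KL.S_filt_replicate[OF b' y(1), of m]
    by (cases m) (auto simp: v_def)
  have v_gr: "v m \<in> gr L 0" for m
    unfolding v_def using y by (intro KL.S_space_gr_0[OF b]) auto
  have w_gr: "w ns \<in> gr M i" for ns
    unfolding w_def using v_gr
    by (intro M.subspace_scale[OF M.gr_subspace] LM.S_space_gr_0[OF a]) auto
  \<comment> \<open>The length bound makes the series over the number of blocks converge; the bound
    by the sum makes the series over the number of arguments converge.\<close>
  have w_flt: "w ns \<in> flt M m" if "m \<le> length ns \<or> m \<le> sum_list ns" for ns m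
  proof -
    have "a (map v ns) \<in> flt M (sum_list (map (max 1) ns) + 0)"
      using v_flt by (intro LM.S_filt_flt[OF a']) (auto simp: list_all2_conv_all_nth)
    moreover have "m \<le> sum_list (map (max 1) ns) + 0"
      using that sum_list_max_one[of ns] by auto
    ultimately have "a (map v ns) \<in> flt M m"
      by (rule M.flt_mono)
    then show ?thesis
      unfolding w_def by (rule M.flt_scale)
  qed
  have T_gr: "T n k \<in> gr M i" for n k
    unfolding T_def using w_gr
    by (intro M.subspace_scale[OF M.gr_subspace] M.subspace_sum[OF M.gr_subspace]) auto
  have T_flt: "T n k \<in> flt M m" if "m \<le> k \<or> m \<le> n" for n k m
    unfolding T_def using w_flt that by (intro M.flt_scale M.flt_sum) (auto simp: A_def)
  \<comment> \<open>On equal arguments of degree 0 all \<open>n!\<close> permutations contribute the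
    same series with sign +1, which cancels the factor \<open>1 / fact n\<close>.\<close>
  have bullet: "scl M (1 / fact n) (bullet K M a b (replicate n y)) = fil_suminf M (T n)" for n
  proof -
    let ?\<Phi> = "\<lambda>ds xs. \<Sum>\<sigma> | \<sigma> permutes {..<length xs}. signed (koszul ds \<sigma>)
       (fil_suminf M (\<lambda>k. scl M (1 / fact k)
          (\<Sum>ns | length ns = k \<and> sum_list ns = length xs.
             scl M (1 / (\<Prod>n\<leftarrow>ns. fact n))
               (a (map b (split_blocks ns (permute_args \<sigma> xs)))))))"
    have "?\<Phi> (replicate n 0) (replicate n y) = (\<Sum>\<sigma> | \<sigma> permutes {..<n}. fil_suminf M (T n))"
      by (auto simp: koszul_replicate permute_args_replicate split_blocks_replicate signed_def
          T_def A_def w_def v_def[abs_def] comp_def intro!: sum.cong arg_cong[of _ _ "fil_suminf M"])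
    also have "\<dots> = scl M (fact n) (fil_suminf M (T n))"
      by (simp add: M.sum_constant_scale card_permutations)
    finally have \<Phi>: "?\<Phi> (replicate n 0) (replicate n y) = scl M (fact n) (fil_suminf M (T n))" .
    \<comment> \<open>Side condition for zero arguments: if \<open>n > 0\<close>, some block is
      nonempty, and \<open>b\<close> vanishes on it.\<close>
    have "fil_suminf M (T n) = 0" if "y = 0" "n > 0"
    proof (rule M.fil_suminf_eqI)
      have "w ns = 0" if ns: "ns \<in> A k n" for ns k
      proof -
        obtain m where m: "m \<in> set ns" "m > 0"
          using ns \<open>n > 0\<close> by (auto simp: A_def) (metis bot_nat_0.not_eq_extremum sum_list_eq_0_iff)
        then have "v m = 0"
          unfolding v_def using \<open>y = 0\<close> by (intro KL.S_space_zero[OF b]) auto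
        then have "0 \<in> set (map v ns)"
          using m by force
        then show ?thesis
          unfolding w_def by (simp add: LM.S_space_zero[OF a])
      qed
      then show "0 - (\<Sum>j<k. T n j) \<in> flt M k" for k
        by (simp add: T_def)
    qed
    then have "bullet K M a b (replicate n y) = scl M (fact n) (fil_suminf M (T n))"
      unfolding bullet_def using y \<Phi> by (subst K.multilinear_ext_replicate[where d = 0]) auto
    then show ?thesis
      by simp
  qed
  define x where "x = taylor L b y"
  define x\<^sub>N where "x\<^sub>N = (\<Sum>m<N. scl L (1 / fact m) (v m))"
  have x: "x \<in> flt L 1" "x \<in> gr L 0"
    unfolding x_def using KL.taylor_flt[OF b' y] KL.taylor_gr[OF b' y] .
  have xN: "x - x\<^sub>N \<in> flt L N"
    unfolding x_def x\<^sub>N_def v_def by (rule KL.taylor_remainder[OF b' y])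
  \<comment> \<open>Modulo step \<open>N\<close>, \<open>x\<close> may be replaced by the truncation
    \<open>x\<^sub>N\<close>. Its expansion runs over lists with entries below \<open>N\<close>;
    those with sum at least \<open>N\<close> lie in step \<open>N\<close>, and the others are
    grouped by their sum.\<close>
  have aN: "a (replicate k x) - (\<Sum>n<N. \<Sum>ns\<in>A k n. w ns) \<in> flt M N" for k
  proof -
    let ?U = "{ns. set ns \<subseteq> {..<N} \<and> length ns = k}"
      and ?V = "{ns. length ns = k \<and> sum_list ns < N}"
    have fin: "finite ?U"
      by (rule finite_lists_length_eq) simp
    have sub: "?V \<subseteq> ?U"
      using member_le_sum_list le_less_trans by blast
    have prod: "(\<Prod>n\<leftarrow>ns. 1 / fact n) = 1 / (\<Prod>n\<leftarrow>ns. fact n :: 'k)" for ns :: "nat list"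
      by (induction ns) auto
    have "a (replicate k x\<^sub>N) = (\<Sum>ns\<in>?U. w ns)"
      unfolding x\<^sub>N_def w_def prod[symmetric]
      using LM.S_space_replicate_sum[OF a, of "{..<N}" "[]"] by simp
    also have "\<dots> = (\<Sum>ns\<in>?U - ?V. w ns) + (\<Sum>ns\<in>?V. w ns)"
      by (rule sum.subset_diff[OF sub fin])
    also have "(\<Sum>ns\<in>?V. w ns) = (\<Sum>n<N. \<Sum>ns | ns \<in> ?V \<and> sum_list ns = n. w ns)"
      using finite_subset[OF sub fin] by (intro sum.group[symmetric]) auto
    also have "\<dots> = (\<Sum>n<N. \<Sum>ns\<in>A k n. w ns)"
      by (intro sum.cong) (auto simp: A_def)
    finally have "a (replicate k x\<^sub>N) - (\<Sum>n<N. \<Sum>ns\<in>A k n. w ns) \<in> flt M N"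
      by (auto intro!: M.flt_sum w_flt)
    then show ?thesis
      using M.flt_trans[of "a (replicate k x)" "a (replicate k x\<^sub>N)" N]
        LM.S_filt_replicate_diff[OF a' xN, of "[]" k] by simp
  qed
  have "taylor M a x - (\<Sum>k<N. scl M (1 / fact k) (a (replicate k x))) \<in> flt M N"
    by (rule LM.taylor_remainder[OF a' x])
  moreover have "(\<Sum>k<N. scl M (1 / fact k) (a (replicate k x))) - (\<Sum>k<N. \<Sum>n<N. T n k) \<in> flt M N"
    unfolding T_def M.scale_sum_right[symmetric] sum_subtractf[symmetric]
      M.scale_right_diff_distrib[symmetric]
    using aN by (intro M.flt_sum M.flt_scale)
  \<comment> \<open>Interchange of the two summations; for each \<open>n\<close> the inner series is
    truncated at \<open>N\<close>.\<close>
  moreover have "(\<Sum>k<N. \<Sum>n<N. T n k) - (\<Sum>n<N. fil_suminf M (T n)) \<in> flt M N"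
  proof -
    have swap: "(\<Sum>k<N. \<Sum>n<N. T n k) = (\<Sum>n<N. \<Sum>k<N. T n k)"
      by (rule sum.swap)
    have "fil_suminf M (T n) - (\<Sum>k<N. T n k) \<in> flt M N" for n
      using T_gr T_flt by (intro M.fil_suminf_remainder[where i = i]) auto
    then have "(\<Sum>n<N. fil_suminf M (T n)) - (\<Sum>n<N. \<Sum>k<N. T n k) \<in> flt M N"
      unfolding sum_subtractf[symmetric] by (intro M.flt_sum)
    then show ?thesis
      unfolding swap by (rule M.flt_diff_commute)
  qed
  ultimately show ?thesis
    unfolding bullet x_def[symmetric] by (rule M.flt_trans[OF M.flt_trans])
qed

section \<open>The Bianchi identity for the curvature of a degree 0 element\<close>

context complete_filtered_complex
begin

sublocale self: complex_pair c C C ..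

text \<open>The Bianchi identity \<open>\<delta>R + \<Sum>\<^sub>m \<lambda>\<^sub>m\<^sub>+\<^sub>1(R, x, \<dots>, x) / m! = 0\<close>, modulo the \<open>N\<close>-th filtration step so
  that only finite sums occur.\<close>

lemma bianchi:
  assumes curved: "curved_Linf c C lam" and x: "x \<in> flt C 1" "x \<in> gr C 0"
    and R: "R = dif C x + taylor C lam x"
  shows "dif C R + (\<Sum>m<N. scl C (1 / fact m) (lam (R # replicate m x))) \<in> flt C N"
proof -
  have lam: "lam \<in> S_space 1 C C" and eq: "S_dif 1 C C lam xs + circ C C lam lam xs = 0" for xs
    using curved by (auto simp: curved_Linf_def)
  note lam' = self.S_space_S_filt[OF lam]
  interpret dif: module_hom "scl C" "scl C" "dif C"
    using dif_linear by (rule Vector_Spaces.linear.axioms(3))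
  have lam_hom: "module_hom (scl C) (scl C) (\<lambda>z. lam (z # ys))" for ys
    using self.S_space_hom[OF lam, of "[]" ys] by simp
  define l where "l n = lam (replicate n x)" for n
  define l' where "l' m z = scl C (1 / fact m) (lam (z # replicate m x))" for m z
  have l'_add: "l' m (y + z) = l' m y + l' m z"
    and l'_diff: "l' m (y - z) = l' m y - l' m z"
    and l'_scale: "l' m (scl C s z) = scl C s (l' m z)"
    and l'_sum: "l' m (sum F A) = (\<Sum>j\<in>A. l' m (F j))" for m y z s F and A :: "nat set"
    unfolding l'_def
    by (simp_all add: module_hom.add[OF lam_hom] module_hom.diff[OF lam_hom] module_hom.sum[OF lam_hom]
      module_hom.scale[OF lam_hom] scale_right_distrib scale_right_diff_distrib scale_sum_right
      mult.commute)
  have l'_flt: "l' m z \<in> flt C (k + m)" if "z \<in> flt C k" for m z k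
    using self.S_filt_Cons[OF lam' that x(1), of m] by (simp add: l'_def flt_scale)
  \<comment> \<open>The degree 1 of \<open>lam\<close> turns the minus sign of \<open>S_dif\<close>
    into a plus. Each of the \<open>n\<close> slots gives the same term once \<open>dif C x\<close>
    is moved to the front; for \<open>n = 0\<close> the scalar 0 removes the term with the truncated
    \<open>n - 1\<close>.\<close>
  have dif_lam: "S_dif 1 C C lam (replicate n x) =
      dif C (l n) + scl C (of_nat n) (lam (dif C x # replicate (n - 1) x))" for n
  proof -
    let ?\<Phi> = "\<lambda>ds xs. dif C (lam xs) -
     signed 1 (\<Sum>j<length xs. signed (sum_list (take j ds)) (lam (xs[j := dif C (xs ! j)])))"
    have "lam ((replicate n x)[j := dif C x]) = lam (dif C x # replicate (n - 1) x)" if "j < n" for j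
      using self.S_space_commute[OF lam x(2) dif_degree[OF x(2)], of "[]" j "replicate (n - Suc j) x"] that
      by (simp add: replicate_update replicate_add[symmetric])
    then have \<Phi>: "?\<Phi> (replicate n 0) (replicate n x) =
        dif C (l n) + scl C (of_nat n) (lam (dif C x # replicate (n - 1) x))"
      by (simp add: signed_def sum_list_replicate l_def sum_constant_scale)
    have "lam (replicate n 0) = 0" "lam (0 # ys) = 0" if "n > 0" for ys
      using that by (auto intro!: self.S_space_zero[OF lam])
    then show ?thesis
      unfolding S_dif_def using x \<Phi>
      by (subst multilinear_ext_replicate[where d = 0]) (auto simp: l_def dif.zero)
  qed
  \<comment> \<open>The \<open>n!\<close> equal permutation terms give the outer factor; the factor
    \<open>1 / fact (n - k)\<close> is absorbed in \<open>l'\<close>.\<close>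
  have circ_lam: "circ C C lam lam (replicate n x) =
      scl C (fact n) (\<Sum>k\<le>n. scl C (1 / fact k) (l' (n - k) (l k)))" for n
  proof -
    let ?\<Phi> = "\<lambda>ds xs. \<Sum>\<sigma> | \<sigma> permutes {..<length xs}. signed (koszul ds \<sigma>)
       (\<Sum>k\<le>length xs. scl C (1 / (fact k * fact (length xs - k)))
          (lam (lam (take k (permute_args \<sigma> xs)) # drop k (permute_args \<sigma> xs))))"
    have "?\<Phi> (replicate n 0) (replicate n x) =
        (\<Sum>\<sigma> | \<sigma> permutes {..<n}. \<Sum>k\<le>n. scl C (1 / fact k) (l' (n - k) (l k)))"
      by (auto simp: koszul_replicate permute_args_replicate signed_def l'_def l_def min_def
          intro!: sum.cong)
    also have "\<dots> = scl C (fact n) (\<Sum>k\<le>n. scl C (1 / fact k) (l' (n - k) (l k)))"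
      by (simp add: sum_constant_scale card_permutations)
    finally have \<Phi>: "?\<Phi> (replicate n 0) (replicate n x) = \<dots>" .
    \<comment> \<open>For \<open>k = 0\<close> the inner value is the curvature
      \<open>lam []\<close>, possibly nonzero, but then the outer bracket has a zero argument. For
      \<open>k > 0\<close> the inner value vanishes.\<close>
    have "l' (n - k) (l k) = 0" if "x = 0" "n > 0" "k \<le> n" for k
    proof (cases "k = 0")
      case True
      then have "lam (l k # replicate (n - k) x) = 0"
        using that by (intro self.S_space_zero[OF lam]) auto
      then show ?thesis
        by (simp add: l'_def)
    next
      case False
      then have "l k = 0"
        unfolding l_def using that by (intro self.S_space_zero[OF lam]) auto
      then show ?thesis
        using l'_scale[of _ 0 0] by simp
    qed
    then show ?thesis
      unfolding circ_def using x \<Phi>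
      by (subst multilinear_ext_replicate[where d = 0]) auto
  qed
  \<comment> \<open>The structure equation on \<open>n\<close> copies of \<open>x\<close>, divided
    by \<open>n!\<close>; the factor \<open>n / n!\<close> becomes
    \<open>1 / (n - 1)!\<close>.\<close>
  have dif_l: "scl C (1 / fact n) (dif C (l n)) = - (if n = 0 then 0 else l' (n - 1) (dif C x))
      - (\<Sum>k\<le>n. scl C (1 / fact k) (l' (n - k) (l k)))" for n
  proof -
    have "dif C (l n) = - scl C (of_nat n) (lam (dif C x # replicate (n - 1) x))
        - scl C (fact n) (\<Sum>k\<le>n. scl C (1 / fact k) (l' (n - k) (l k)))"
      using eq[of "replicate n x"] unfolding dif_lam circ_lam by (simp add: algebra_simps eq_neg_iff_add_eq_0)
    moreover have "scl C (1 / fact n) (scl C (of_nat n) (lam (dif C x # replicate (n - 1) x))) =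
        (if n = 0 then 0 else l' (n - 1) (dif C x))"
      by (cases n) (auto simp: l'_def fact_reduce of_nat_neq_0[unfolded of_nat_Suc])
    ultimately show ?thesis
      by (simp add: scale_right_diff_distrib)
  qed
  let ?S = "\<Sum>k<N. scl C (1 / fact k) (l k)"
  have S: "taylor C lam x - ?S \<in> flt C N"
    unfolding l_def by (rule self.taylor_remainder[OF lam' x])
  \<comment> \<open>Cauchy product: the triangle \<open>k + m < N\<close> differs from the full
    square by terms in step \<open>k + m\<close>, hence in step \<open>N\<close>.\<close>
  have tri: "(\<Sum>n<N. \<Sum>k\<le>n. scl C (1 / fact k) (l' (n - k) (l k))) - (\<Sum>m<N. l' m ?S) \<in> flt C N"
  proof -
    let ?t = "\<lambda>(k, m). scl C (1 / fact k) (l' m (l k))"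
    let ?U = "{..<N} \<times> {..<N}" and ?V = "{(k, m). k + m < N}"
    have sub: "?V \<subseteq> ?U"
      by auto
    have "(\<Sum>n<N. \<Sum>k\<le>n. scl C (1 / fact k) (l' (n - k) (l k))) = sum ?t ?V"
      by (subst sum.triangle_reindex) (simp add: case_prod_unfold)
    moreover have "(\<Sum>m<N. l' m ?S) = sum ?t ?U"
      unfolding l'_sum l'_scale by (subst sum.swap) (simp add: sum.cartesian_product)
    moreover have "sum ?t ?U = sum ?t (?U - ?V) + sum ?t ?V"
      using sub by (intro sum.subset_diff) auto
    moreover have "sum ?t (?U - ?V) \<in> flt C N"
    proof (rule flt_sum)
      fix p assume "p \<in> ?U - ?V"
      then obtain k m where p: "p = (k, m)" and "\<not> k + m < N"
        by auto
      have "l k \<in> flt C k"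
        using self.S_filt_replicate[OF lam' x(1), of k] by (simp add: l_def)
      then have "l' m (l k) \<in> flt C N"
        using l'_flt[of "l k" k m] \<open>\<not> k + m < N\<close> flt_mono by auto
      then show "?t p \<in> flt C N"
        by (simp add: p flt_scale)
    qed
    ultimately show ?thesis
      by (simp add: flt_neg)
  qed
  \<comment> \<open>After reindexing, only the term with \<open>m = N - 1\<close> is left over; it
    lies in step \<open>N\<close> because \<open>dif C x\<close> lies in step 1.\<close>
  have shift: "(\<Sum>n<N. if n = 0 then 0 else l' (n - 1) (dif C x)) - (\<Sum>m<N. l' m (dif C x)) \<in> flt C N"
  proof (cases N)
    case (Suc N')
    have "dif C x \<in> flt C 1"
      using x(1) by (rule dif_flt)
    from l'_flt[OF this, of N'] show ?thesis
      unfolding Suc by (subst sum.lessThan_Suc_shift) (simp add: flt_neg)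
  qed simp
  \<comment> \<open>As the differential squares to zero, \<open>dif C R\<close> is the differential
    of the series alone.\<close>
  have "dif C R - dif C ?S \<in> flt C N"
    using dif_flt[OF S] R by (simp add: dif.diff dif.add dif_square)
  moreover have "dif C ?S + ((\<Sum>m<N. l' m (dif C x)) + (\<Sum>m<N. l' m ?S)) \<in> flt C N"
  proof -
    have eq: "dif C ?S = - (\<Sum>n<N. if n = 0 then 0 else l' (n - 1) (dif C x))
        - (\<Sum>n<N. \<Sum>k\<le>n. scl C (1 / fact k) (l' (n - k) (l k)))"
      by (simp only: dif.sum dif.scale dif_l sum_subtractf sum_negf)
    have *: "- A - B + (P + Q) = - ((A - P) + (B - Q))" for A B P Q :: 'v
      by simp
    show ?thesis
      unfolding eq * by (intro flt_neg flt_add shift tri)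
  qed
  moreover have "(\<Sum>m<N. l' m (taylor C lam x)) - (\<Sum>m<N. l' m ?S) \<in> flt C N"
    unfolding sum_subtractf[symmetric] l'_diff[symmetric]
    by (intro flt_sum flt_mono[OF l'_flt[OF S]]) simp
  ultimately have "dif C R - dif C ?S + (dif C ?S + ((\<Sum>m<N. l' m (dif C x)) + (\<Sum>m<N. l' m ?S)))
      + ((\<Sum>m<N. l' m (taylor C lam x)) - (\<Sum>m<N. l' m ?S)) \<in> flt C N"
    by (rule flt_add[OF flt_add])
  moreover have "D - E + (E + (P + Q)) + (T - Q) = D + (P + T)" for D E P Q T :: 'v
    by simp
  ultimately have "dif C R + (\<Sum>m<N. l' m R) \<in> flt C N"
    by (simp only: R l'_add sum.distrib)
  then show ?thesis
    by (simp add: l'_def)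
qed

end

section \<open>Gauge-fixed Maurer-Cartan elements and the transferred structure\<close>

theorem theorem1:
  fixes c :: real
    and L :: "('k::field_char_0, 'l::ab_group_add) fcomplex"
    and M :: "('k, 'm::ab_group_add) fcomplex"
    and lam :: "'l list \<Rightarrow> 'l"
    and f :: "'m \<Rightarrow> 'l" and g :: "'l \<Rightarrow> 'm" and h :: "'l \<Rightarrow> 'l"
    and F :: "'m list \<Rightarrow> 'l" and mu :: "'m list \<Rightarrow> 'm"
  assumes "curved_Linf c L lam" and "pro_nilpotent L lam"
    and "complete_filtered_complex c M"
    and "hpt_context L M f g h"
    and "F \<in> S_space 0 M L"
    and "F = (\<lambda>ys. lin_elem f ys - h (bullet M L lam F ys))"
    and "mu = (\<lambda>ys. g (bullet M L lam F ys))"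
  shows "bij_betw g (MC_gauge L lam h) (MC M mu)"
proof -
  interpret L: complete_filtered_complex c L
    using assms(1) by (simp add: curved_Linf_def)
  interpret M: complete_filtered_complex c M
    by fact
  interpret MtoL: complex_pair c M L ..
  interpret LM: complex_pair c L M ..
  note curved = assms(1) and F = assms(5) and F_eq = assms(6) and mu_eq = assms(7)
  have lam1: "lam \<in> S_filt 1 1 L L"
    using assms(2) by (simp add: pro_nilpotent_def)
  note lam = L.self.S_filt_S_space[OF lam1]
  note F' = MtoL.S_space_S_filt[OF F]
  have f: "complex_morphism M L f" "filtration_preserving M L f"
    and g: "complex_morphism L M g" "filtration_preserving L M g"
    and h: "Vector_Spaces.linear (scl L) (scl L) h" "degree_map (-1) L L h"
      "filtration_preserving L L h"
    and gf: "g (f y) = y" and hh: "h (h x) = 0" and hf: "h (f y) = 0" and gh: "g (h x) = 0"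
    and homotopy: "x = f (g x) + dif L (h x) + h (dif L x)" for x y
    using assms(4) unfolding hpt_context_def by auto
  have g_dif: "g (dif L x) = dif M (g x)" for x
    using g(1) by (simp add: complex_morphism_def)
  interpret f: module_hom "scl M" "scl L" f
    using f(1) by (simp add: complex_morphism_def Vector_Spaces.linear.axioms(3))
  interpret g: module_hom "scl L" "scl M" g
    using g(1) by (simp add: complex_morphism_def Vector_Spaces.linear.axioms(3))
  interpret h: module_hom "scl L" "scl L" h
    using h(1) by (rule Vector_Spaces.linear.axioms(3))
  interpret dif: module_hom "scl L" "scl L" "dif L"
    using L.dif_linear by (rule Vector_Spaces.linear.axioms(3))
  have f_gr: "f y \<in> gr L 0" if "y \<in> gr M 0" for y
    using f(1) that by (fastforce simp: complex_morphism_def degree_map_def)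
  have g_gr: "g x \<in> gr M 0" if "x \<in> gr L 0" for x
    using g(1) that by (fastforce simp: complex_morphism_def degree_map_def)

  \<comment> \<open>The equations for \<open>F\<close> and \<open>mu\<close> as identities between
    Taylor series\<close>
  define \<Lambda> where "\<Lambda> = taylor L lam"
  define \<Phi> where "\<Phi> = taylor L F"
  have \<Phi>: "\<Phi> y \<in> flt L 1" "\<Phi> y \<in> gr L 0" if "y \<in> flt M 1" "y \<in> gr M 0" for y
    unfolding \<Phi>_def using MtoL.taylor_flt[OF F' that] MtoL.taylor_gr[OF F' that] .
  have bullet: "\<Lambda> (\<Phi> y) - (\<Sum>n<N. scl L (1 / fact n) (bullet M L lam F (replicate n y))) \<in> flt L N"
    if "y \<in> flt M 1" "y \<in> gr M 0" for y N
    unfolding \<Lambda>_def \<Phi>_def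
    by (rule bullet_taylor_remainder[OF assms(3) L.complete_filtered_complex_axioms
      L.complete_filtered_complex_axioms lam F that])
  have \<Phi>_fixpoint: "\<Phi> y = f y - h (\<Lambda> (\<Phi> y))" if y: "y \<in> flt M 1" "y \<in> gr M 0" for y
  proof -
    have "fil_suminf L (\<lambda>n. scl L (1 / fact n) (F (replicate n y))) = f y - h (\<Lambda> (\<Phi> y))"
    proof (rule L.fil_suminf_eqI)
      fix N
      \<comment> \<open>The only nonzero term of this series is the one for \<open>n = 1\<close>.
        For \<open>N \<le> 1\<close> it is not yet included, but \<open>f y\<close> lies in step
        1.\<close>
      have "f y - (\<Sum>n<N. scl L (1 / fact n) (lin_elem f (replicate n y))) \<in> flt L N"
      proof (cases "N \<le> 1")
        case True
        then show ?thesis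
          using MtoL.flt_image[OF f(2) y(1)] L.flt_0 by (cases N) (auto simp: lin_elem_def)
      next
        case False
        have "(\<Sum>n<N. scl L (1 / fact n) (lin_elem f (replicate n y))) = (\<Sum>n\<in>{1::nat}. f y)"
          using False by (intro sum.mono_neutral_cong_right)
            (auto simp: lin_elem_def split: list.splits dest!: arg_cong[of _ _ length])
        then show ?thesis
          by simp
      qed
      moreover have "h (\<Lambda> (\<Phi> y)) - (\<Sum>n<N. scl L (1 / fact n) (h (bullet M L lam F (replicate n y)))) \<in> flt L N"
        using L.self.flt_image[OF h(3) bullet[OF y, of N]] by (simp add: h.diff h.sum h.scale)
      ultimately have "f y - (\<Sum>n<N. scl L (1 / fact n) (lin_elem f (replicate n y)))
        - (h (\<Lambda> (\<Phi> y)) - (\<Sum>n<N. scl L (1 / fact n) (h (bullet M L lam F (replicate n y))))) \<in> flt L N"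
        by (rule L.flt_diff)
      then show "f y - h (\<Lambda> (\<Phi> y)) - (\<Sum>n<N. scl L (1 / fact n) (F (replicate n y))) \<in> flt L N"
        by (subst F_eq) (simp add: L.scale_right_diff_distrib sum_subtractf algebra_simps)
    qed
    then show ?thesis
      by (metis \<Phi>_def taylor_def)
  qed
  have taylor_mu: "taylor M mu y = g (\<Lambda> (\<Phi> y))" if y: "y \<in> flt M 1" "y \<in> gr M 0" for y
    unfolding taylor_def
  proof (rule M.fil_suminf_eqI)
    show "g (\<Lambda> (\<Phi> y)) - (\<Sum>n<N. scl M (1 / fact n) (mu (replicate n y))) \<in> flt M N" for N
      using LM.flt_image[OF g(2) bullet[OF y, of N]] by (simp add: mu_eq g.diff g.sum g.scale)
  qed
  have fixpoint_unique: "x = x'"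
    if x: "x \<in> flt L 1" "x \<in> gr L 0" "x = z - h (\<Lambda> x)"
      and x': "x' \<in> flt L 1" "x' \<in> gr L 0" "x' = z - h (\<Lambda> x')" for x x' z
  proof -
    have "x - x' \<in> flt L m" for m
    proof (induction m)
      case (Suc m)
      \<comment> \<open>Pro-nilpotency is the gain of one step here, and \<open>h\<close> preserves
        it.\<close>
      then have "h (\<Lambda> x - \<Lambda> x') \<in> flt L (m + 1)"
        unfolding \<Lambda>_def using x x'
        by (intro L.self.flt_image[OF h(3)] L.self.taylor_diff[OF lam1])
      moreover have "x - x' = - h (\<Lambda> x - \<Lambda> x')"
        unfolding h.diff by (subst x(3), subst x'(3)) simp
      ultimately show ?case
        using L.flt_neg by simp
    qed (simp add: L.flt_0)
    then show ?thesis
      using L.flt_separated[of "x - x'"] by simp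
  qed
  have MC_L: "x \<in> MC L lam \<longleftrightarrow> x \<in> flt L 1 \<and> x \<in> gr L 0 \<and> dif L x + \<Lambda> x = 0" for x
    by (auto simp: MC_def taylor_def \<Lambda>_def)
  have MC_M: "y \<in> MC M mu \<longleftrightarrow> y \<in> flt M 1 \<and> y \<in> gr M 0 \<and> dif M y + g (\<Lambda> (\<Phi> y)) = 0" for y
    using taylor_mu by (auto simp: MC_def taylor_def)

  \<comment> \<open>From gauge-fixed solutions in \<open>L\<close> to solutions in
    \<open>M\<close>\<close>
  have inverse_left: "\<Phi> (g x) = x" and g_MC: "g x \<in> MC M mu" if x: "x \<in> MC_gauge L lam h" for x
  proof -
    have x1: "x \<in> flt L 1" "x \<in> gr L 0" and mc: "dif L x + \<Lambda> x = 0" and hx: "h x = 0"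
      using x by (auto simp: MC_gauge_def MC_L)
    have y: "g x \<in> flt M 1" "g x \<in> gr M 0"
      using LM.flt_image[OF g(2) x1(1)] g_gr[OF x1(2)] .
    have dx: "dif L x = - \<Lambda> x"
      using mc by (simp add: eq_neg_iff_add_eq_0)
    have "x = f (g x) - h (\<Lambda> x)"
      using homotopy[of x] by (simp add: hx dx h.neg)
    \<comment> \<open>Both sides are fixed points of the map sending \<open>z\<close> to
      \<open>f (g x) - h (\<Lambda> z)\<close>.\<close>
    then show inv: "\<Phi> (g x) = x"
      using fixpoint_unique \<Phi>[OF y] \<Phi>_fixpoint[OF y] x1 by blast
    have "dif M (g x) + g (\<Lambda> x) = 0"
      using mc g.zero by (simp add: g_dif[symmetric] g.add[symmetric])
    then show "g x \<in> MC M mu"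
      unfolding MC_M inv using y by blast
  qed

  \<comment> \<open>From solutions in \<open>M\<close> back to gauge-fixed solutions in
    \<open>L\<close>\<close>
  have inverse_right: "g (\<Phi> y) = y" and \<Phi>_MC: "\<Phi> y \<in> MC_gauge L lam h" if "y \<in> MC M mu" for y
  proof -
    have y: "y \<in> flt M 1" "y \<in> gr M 0" and mc: "dif M y + g (\<Lambda> (\<Phi> y)) = 0"
      using that by (auto simp: MC_M)
    define x where "x = \<Phi> y"
    define R where "R = dif L x + \<Lambda> x"
    have x1: "x \<in> flt L 1" "x \<in> gr L 0"
      unfolding x_def by (rule \<Phi>[OF y])+
    have x: "x = f y - h (\<Lambda> x)"
      unfolding x_def by (rule \<Phi>_fixpoint[OF y])
    have gx: "g x = y"
      by (subst x) (simp add: g.diff gf gh)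
    have hx: "h x = 0"
      by (subst x) (simp add: h.diff hf hh)
    have gR: "g R = 0"
      using mc by (simp add: R_def g.add g_dif gx x_def[symmetric])
    \<comment> \<open>Two expressions for \<open>x\<close>: the homotopy formula with
      \<open>h x = 0\<close> and the fixed-point equation. Cancelling \<open>f y\<close> gives
      \<open>h R = 0\<close>.\<close>
    have "f y + h (dif L x) = f y - h (\<Lambda> x)"
      using homotopy[of x] x[symmetric] by (simp add: hx gx dif.zero)
    then have "h (dif L x) = - h (\<Lambda> x)"
      unfolding diff_conv_add_uminus by (rule add_left_imp_eq)
    then have hR: "h R = 0"
      by (simp add: R_def h.add)
    have R_eq: "R = h (dif L R)"
      using homotopy[of R] by (simp add: gR hR f.zero dif.zero)
    have "R \<in> flt L m" for m
    proof (induction m)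
      case (Suc m)
      \<comment> \<open>The extra step comes from pro-nilpotency, so even the term
        \<open>k = 0\<close> gains one. Truncating the Bianchi identity at \<open>Suc m\<close> is
        thus exact enough for the induction.\<close>
      have "lam (R # replicate k x) \<in> flt L (Suc m)" for k
        using L.self.S_filt_Cons[OF lam1 Suc x1(1), of k] L.flt_mono by auto
      then have "(\<Sum>k<Suc m. scl L (1 / fact k) (lam (R # replicate k x))) \<in> flt L (Suc m)"
        by (intro L.flt_sum L.flt_scale)
      moreover have "dif L R + (\<Sum>k<Suc m. scl L (1 / fact k) (lam (R # replicate k x))) \<in> flt L (Suc m)"
        by (rule L.bianchi[OF curved x1]) (simp add: R_def \<Lambda>_def)
      ultimately have "dif L R \<in> flt L (Suc m)"
        using L.flt_diff by fastforce
      then show ?case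
        using L.self.flt_image[OF h(3)] R_eq by metis
    qed (simp add: L.flt_0)
    then have "R = 0"
      by (rule L.flt_separated)
    then show "\<Phi> y \<in> MC_gauge L lam h"
      unfolding MC_gauge_def mem_Collect_eq MC_L x_def[symmetric] using x1 hx R_def by simp
    show "g (\<Phi> y) = y"
      using gx by (simp add: x_def)
  qed
  show ?thesis
    by (rule bij_betwI[of g _ _ \<Phi>]) (auto simp: inverse_left inverse_right g_MC \<Phi>_MC)
qed

end
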